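(* Let $X\subseteq\mathbb{R}^n$ be a non-empty compact set and $x\in X$. The suboptimality loss $\ell^{\mathrm{sub}}$ is the Fenchel--Young loss with $\Omega=I_X$; that is, writing $L_X(\cdot;x)$ for the Fenchel--Young loss $L_{I_X}(\cdot;x)$, for any $\hat c\in\mathbb{R}^n$ and $\hat x\in\arg\max_{x'\in X}\langle\hat c,x'\rangle$, $$L_X(\hat c;x)=\max_{x'\in X}\langle\hat c,x'\rangle-\langle\hat c,x\rangle=\langle\hat c,\hat x-x\rangle=\ell^{\mathrm{sub}}(\hat c).$$
   Context: $\langle\cdot,\cdot\rangle$ is the standard inner product on $\mathbb{R}^n$. For a (possibly non-convex) lower semi-continuous function $\Omega\colon\mathbb{R}^n\to\mathbb{R}\cup\{+\infty\}$ and $x\in\mathbb{R}^n$ with $\Omega(x)<+\infty$, the Fenchel--Young loss is $L_\Omega(c;x)=\Omega^*(c)+\Omega(x)-\langle c,x\rangle$ for $c\in\mathbb{R}^n$, where $\Omega^*(c)=\sup_{x'\in\mathbb{R}^n}\left(\langle c,x'\rangle-\Omega(x')\right)$ is the convex conjugate. $I_X$ is the indicator function of $X$: $I_X(x')=0$ if $x'\in X$ and $+\infty$ otherwise. The suboptimality loss associated with $(X,x)$ is $\ell^{\mathrm{sub}}(\hat c)=\langle\hat c,\hat x-x\rangle$ with $\hat x\in\arg\max_{x'\in X}\langle\hat c,x'\rangle$. *)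

theory Defs
  imports "HOL-Analysis.Analysis"
begin

text \<open>Functions into \<open>\<real> \<union> {+\<infinity>}\<close> are rendered as \<^typ>\<open>ereal\<close>-valued functions that
  never take the value \<open>-\<infinity>\<close>.\<close>

definition lower_semicontinuous :: "('a::topological_space \<Rightarrow> ereal) \<Rightarrow> bool" where
  "lower_semicontinuous f \<longleftrightarrow> (\<forall>x. f x \<le> Liminf (at x) f)"

definition convex_conjugate :: "('a::real_inner \<Rightarrow> ereal) \<Rightarrow> 'a \<Rightarrow> ereal" where
  "convex_conjugate \<Omega> c = (SUP x'. ereal (c \<bullet> x') - \<Omega> x')"

text \<open>The conditions on \<open>\<Omega>\<close> and \<open>x\<close> under which the Fenchel--Young loss is defined. They also
  ensure that no \<open>\<infinity> - \<infinity>\<close> occurs in the two formulas; convexity is not required.\<close>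

definition fenchel_young_admissible :: "('a::real_inner \<Rightarrow> ereal) \<Rightarrow> 'a \<Rightarrow> bool" where
  "fenchel_young_admissible \<Omega> x \<longleftrightarrow>
     (\<forall>z. \<Omega> z \<noteq> -\<infinity>) \<and> lower_semicontinuous \<Omega> \<and> \<Omega> x < \<infinity>"

definition fenchel_young_loss :: "('a::real_inner \<Rightarrow> ereal) \<Rightarrow> 'a \<Rightarrow> 'a \<Rightarrow> ereal" where
  "fenchel_young_loss \<Omega> x c = convex_conjugate \<Omega> c + \<Omega> x - ereal (c \<bullet> x)"

definition set_indicator :: "'a set \<Rightarrow> 'a \<Rightarrow> ereal" where
  "set_indicator X z = (if z \<in> X then 0 else \<infinity>)"

text \<open>\<^const>\<open>arg_max_on\<close> picks some maximizer; that the loss does not depend on which one is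
  picked is not built into the definition.\<close>

definition suboptimality_loss :: "'a::real_inner set \<Rightarrow> 'a \<Rightarrow> 'a \<Rightarrow> real" where
  "suboptimality_loss X x c = c \<bullet> (arg_max_on (\<lambda>x'. c \<bullet> x') X - x)"

end

theory Submission
  imports Defs
begin

text \<open>Subtracting the indicator of X sends every point outside X to -\<infinity>, so the
  supremum in the conjugate is taken over X alone: the conjugate is the support function of X
  (\<open>convex_conjugate_set_indicator\<close>). Compactness makes it an attained, hence finite,
  maximum. As the indicator vanishes at x, the loss is this maximum minus the inner product of c and
  x, and bilinearity gives the form with xh. All maximizers share one value, so the one picked by
  \<open>arg_max_on\<close> gives the same loss (\<open>arg_max_on_value\<close>).\<close>

lemma lower_semicontinuous_set_indicator:
  fixes X :: "'a::topological_space set"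
  assumes "closed X"
  shows "lower_semicontinuous (set_indicator X)"
  unfolding lower_semicontinuous_def
proof
  fix z :: 'a
  show "set_indicator X z \<le> Liminf (at z) (set_indicator X)"
  proof (rule Liminf_bounded, cases "z \<in> X")
    \<comment> \<open>On X the indicator takes its least value 0, so the bound holds at every
      y.\<close>
    case True
    then show "\<forall>\<^sub>F y in at z. set_indicator X z \<le> set_indicator X y"
      by (simp add: set_indicator_def)
  next
    case False
    \<comment> \<open>The complement of the closed set X is an open neighbourhood of z, on which the
      indicator is constantly \<infinity>.\<close>
    with assms have "\<forall>\<^sub>F y in at z. y \<in> - X"
      by (intro eventually_at_in_open') auto
    then show "\<forall>\<^sub>F y in at z. set_indicator X z \<le> set_indicator X y"
      by eventually_elim (simp add: set_indicator_def)
  qed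
qed

lemma is_arg_max_in_iff:
  fixes f :: "'a \<Rightarrow> 'b::linorder"
  shows "is_arg_max f (\<lambda>x. x \<in> X) m \<longleftrightarrow> m \<in> X \<and> (\<forall>y\<in>X. f y \<le> f m)"
  by (auto simp: is_arg_max_def not_less)

text \<open>\<open>GREATEST\<close> is a definite description; a maximizer supplies the greatest
  element that gives it meaning.\<close>

lemma Greatest_image_is_arg_max:
  fixes f :: "'a \<Rightarrow> 'b::linorder"
  assumes "is_arg_max f (\<lambda>x. x \<in> X) m"
  shows "(GREATEST v. v \<in> f ` X) = f m"
  using assms by (intro Greatest_equality) (auto simp: is_arg_max_in_iff)

text \<open>Since a maximizer exists, the choice operator returns one. It may differ from m, but
  each of the two values bounds the other.\<close>

lemma arg_max_on_value:
  fixes f :: "'a \<Rightarrow> 'b::linorder"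
  assumes "is_arg_max f (\<lambda>x. x \<in> X) m"
  shows "f (arg_max_on f X) = f m"
proof -
  have "is_arg_max f (\<lambda>x. x \<in> X) (arg_max_on f X)"
    unfolding arg_max_on_def arg_max_def using assms by (rule someI)
  with assms show ?thesis
    by (auto simp: is_arg_max_in_iff intro: antisym)
qed

text \<open>Terms off X equal -\<infinity> and those on X are bounded by the value at m, which is
  itself one of the terms.\<close>

lemma convex_conjugate_set_indicator:
  assumes "is_arg_max (\<lambda>x'. c \<bullet> x') (\<lambda>x'. x' \<in> X) m"
  shows "convex_conjugate (set_indicator X) c = ereal (c \<bullet> m)"
  unfolding convex_conjugate_def
proof (rule antisym)
  show "(SUP x'. ereal (c \<bullet> x') - set_indicator X x') \<le> ereal (c \<bullet> m)"
    using assms by (intro SUP_least) (auto simp: set_indicator_def is_arg_max_in_iff)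
  show "ereal (c \<bullet> m) \<le> (SUP x'. ereal (c \<bullet> x') - set_indicator X x')"
    using assms by (intro SUP_upper2[of m]) (auto simp: set_indicator_def is_arg_max_in_iff)
qed

theorem proposition3p1:
  fixes X :: "(real ^ 'n) set" and x :: "real ^ 'n"
  assumes "X \<noteq> {}" and "compact X" and "x \<in> X"
  shows "fenchel_young_admissible (set_indicator X) x \<and>
    (\<forall>c :: real ^ 'n.
       (\<exists>xh. is_arg_max (\<lambda>x'. c \<bullet> x') (\<lambda>x'. x' \<in> X) xh) \<and>
       (\<forall>xh. is_arg_max (\<lambda>x'. c \<bullet> x') (\<lambda>x'. x' \<in> X) xh \<longrightarrow>
          fenchel_young_loss (set_indicator X) x c
            = ereal ((GREATEST v. v \<in> (\<lambda>x'. c \<bullet> x') ` X) - c \<bullet> x) \<and>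
          (GREATEST v. v \<in> (\<lambda>x'. c \<bullet> x') ` X) - c \<bullet> x = c \<bullet> (xh - x) \<and>
          c \<bullet> (xh - x) = suboptimality_loss X x c))"
proof (intro conjI allI impI)
  show "fenchel_young_admissible (set_indicator X) x"
    using assms lower_semicontinuous_set_indicator[OF compact_imp_closed]
    by (simp add: fenchel_young_admissible_def set_indicator_def)
next
  fix c :: "real ^ 'n"
  have "continuous_on X (\<lambda>x'. c \<bullet> x')"
    by (intro continuous_intros)
  \<comment> \<open>The extreme value theorem; it keeps the claim about all maximizers xh from being
    vacuous.\<close>
  from continuous_attains_sup[OF assms(2,1) this]
  show "\<exists>xh. is_arg_max (\<lambda>x'. c \<bullet> x') (\<lambda>x'. x' \<in> X) xh"
    by (auto simp: is_arg_max_in_iff)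
next
  fix c xh :: "real ^ 'n"
  assume xh: "is_arg_max (\<lambda>x'. c \<bullet> x') (\<lambda>x'. x' \<in> X) xh"
  note max = Greatest_image_is_arg_max[OF xh]
  show "fenchel_young_loss (set_indicator X) x c
      = ereal ((GREATEST v. v \<in> (\<lambda>x'. c \<bullet> x') ` X) - c \<bullet> x)"
    unfolding max using assms(3)
    by (simp add: fenchel_young_loss_def convex_conjugate_set_indicator[OF xh] set_indicator_def)
  show "(GREATEST v. v \<in> (\<lambda>x'. c \<bullet> x') ` X) - c \<bullet> x = c \<bullet> (xh - x)"
    unfolding max by (simp add: inner_diff_right)
  show "c \<bullet> (xh - x) = suboptimality_loss X x c"
    using arg_max_on_value[OF xh] by (simp add: suboptimality_loss_def inner_diff_right)
qed

end
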